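(* Let $N\in\mathbb{N}$, $N\ge2$, let $\mathcal{S}=(\sigma(0),\sigma(1),\ldots)\subseteq\mathbb{N}_0$ be a list with $\sigma(0)=0$ such that $m_i:=\sigma(i+1)-\sigma(i)\in\{1,2,\ldots,N-1\}$ for all $i\in\mathbb{N}_0$, let $x_0\in\mathbb{X}$, and let $(x_i)_{i\in\mathbb{N}_0}$, $x_{i+1}=x_{u_N}(m_i;x_i)$, be the closed loop trajectory at the update instants generated by the feedback law $\mu_N^{\mathcal{S}}$. Let $\overline{\alpha}\in(0,1]$ be fixed and $$\rho_i:=V_N(x_i)-V_N(x_{u_N}(m_i;x_i))-\overline{\alpha}\sum_{k=0}^{m_i-1}\ell\big(x_{u_N}(k;x_i),u_N(k;x_i)\big),\qquad s_n:=\sum_{i=0}^n\rho_i .$$ Then the following hold. (i) For every $n\in\mathbb{N}_0$, the largest real number $\alpha$ satisfying $$V_N(x_{n+1})+\alpha\sum_{i=0}^n\sum_{k=0}^{m_i-1}\ell\big(x_{u_N}(k;x_i),u_N(k;x_i)\big)\ \le\ V_N(x_0)$$ is $$\alpha=\frac{V_N(x_0)-V_N(x_{n+1})}{V_N(x_0)-V_N(x_{n+1})-s_n}\,\overline{\alpha}.$$ (ii) If $(s_n)_{n\in\mathbb{N}_0}$ converges with $\lim_{n\to\infty}s_n=\theta$, then $$\alpha\,V_\infty(x_0)\ \le\ \alpha\,V_\infty^{\mu_N^{\mathcal{S}}}(x_0)\ \le\ V_N(x_0)\ \le\ V_\infty(x_0)\qquad\text{with}\qquad \alpha=\frac{\o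verline{\alpha}\,V_N(x_0)}{V_N(x_0)-\theta}.$$
   Context: Let $X,U$ be Banach spaces with metrics $d_X,d_U$, let $\mathbb{X}\subset X$, $\mathbb{U}\subset U$ (state and control constraints), and let $f:X\times U\to X$ define the system $x(n+1)=f(x(n),u(n))$, $x(0)=x_0$. For a control sequence $u$, $x_u(\cdot;x_0)$ denotes the resulting trajectory with $x_u(0;x_0)=x_0$. Let $x^\star\in\mathbb{X}$ and $u^\star\in\mathbb{U}$ with $f(x^\star,u^\star)=x^\star$. The stage cost $\ell:X\times U\to[0,\infty)$ is continuous, $\ell(x^\star,u^\star)=0$, and $\ell(x,u)>0$ for all $u\in U$ and all $x\ne x^\star$. Viability is assumed: for every $x\in\mathbb{X}$ there is $u_x\in\mathbb{U}$ with $f(x,u_x)\in\mathbb{X}$. Infinite horizon: $J_\infty(x_0,u)=\sum_{n=0}^\infty\ell(x_u(n;x_0),u(n))$ and $V_\infty(x_0)=\inf J_\infty(x_0,u)$ over all $u:\mathbb{N}_0\to\mathbb{U}$ with $x_u(n;x_0)\in\mathbb{X}$ for all $n\in\mathbb{N}$ (values in $[0,\infty]$). Finite horizon: $J_N(x_0,u)=\sum_{k=0}^{N-1}\ell(x_u(k;x_0),u(k))$, and $V_N(x_0)$ is the minimum of $J_N(x_0,u)$ over all $u\in\mathbb{U}^N$ with $x_u(k;x_0)\in\mathbb{X}$ for $k=1,\ldots,N$. Minima are assumed to be attained. $u_N(\cdot;x_0)$ denotes a (chosen) minimizer, and $x_{u_N}(\cdot;x_0)$ the corresponding open loop trajectory.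 Multistep MPC: at each update instant $\sigma(i)$, in state $x_i$, the first $m_i$ elements of $u_N(\cdot;x_i)$ are applied, i.e. $\mu_N^{\mathcal{S}}(k;x_i)=u_N(k;x_i)$ for $k=0,\ldots,m_i-1$. The closed loop cost is $V_\infty^{\mu_N^{\mathcal{S}}}(x_0)=\sum_{i=0}^\infty\sum_{k=0}^{m_i-1}\ell(x_{u_N}(k;x_i),\mu_N^{\mathcal{S}}(k;x_i))$.
   Formalization: Part (i) is stated only for x_0 ≠ x^⋆: at x_0 = x^⋆ all costs and values V_N vanish, so every real α satisfies the inequality, no largest one exists, and the formula is 0/0. *)

theory Defs
  imports Complex_Main "HOL-Library.FuncSet" "HOL-Library.Extended_Real"
begin

primrec traj :: "('x \<times> 'u \<Rightarrow> 'x) \<Rightarrow> (nat \<Rightarrow> 'u) \<Rightarrow> 'x \<Rightarrow> nat \<Rightarrow> 'x" where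
  "traj f u x 0 = x"
| "traj f u x (Suc n) = f (traj f u x n, u n)"

definition J_fin ::
  "('x \<times> 'u \<Rightarrow> 'x) \<Rightarrow> ('x \<times> 'u \<Rightarrow> real) \<Rightarrow> nat \<Rightarrow> 'x \<Rightarrow> (nat \<Rightarrow> 'u) \<Rightarrow> real" where
  "J_fin f ell N x u = (\<Sum>k<N. ell (traj f u x k, u k))"

definition J_inf ::
  "('x \<times> 'u \<Rightarrow> 'x) \<Rightarrow> ('x \<times> 'u \<Rightarrow> real) \<Rightarrow> 'x \<Rightarrow> (nat \<Rightarrow> 'u) \<Rightarrow> ereal" where
  "J_inf f ell x u = (\<Sum>n. ereal (ell (traj f u x n, u n)))"

(* A control in U^N is represented by a function on nat of which only the values at
   0, ..., N - 1 matter: neither traj at times up to N nor J_fin f ell N looks at the others. *)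
definition adm_fin ::
  "('x \<times> 'u \<Rightarrow> 'x) \<Rightarrow> 'x set \<Rightarrow> 'u set \<Rightarrow> nat \<Rightarrow> 'x \<Rightarrow> (nat \<Rightarrow> 'u) set" where
  "adm_fin f XX UU N x = {u \<in> {..<N} \<rightarrow> UU. \<forall>k\<in>{1..N}. traj f u x k \<in> XX}"

definition adm_inf ::
  "('x \<times> 'u \<Rightarrow> 'x) \<Rightarrow> 'x set \<Rightarrow> 'u set \<Rightarrow> 'x \<Rightarrow> (nat \<Rightarrow> 'u) set" where
  "adm_inf f XX UU x = {u \<in> UNIV \<rightarrow> UU. \<forall>n\<ge>1. traj f u x n \<in> XX}"

(* This infimum of reals is the minimum whenever a minimizer exists. *)
definition V_fin ::
  "('x \<times> 'u \<Rightarrow> 'x) \<Rightarrow> ('x \<times> 'u \<Rightarrow> real) \<Rightarrow> 'x set \<Rightarrow> 'u set \<Rightarrow> nat \<Rightarrow> 'x \<Rightarrow> real" where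
  "V_fin f ell XX UU N x = (INF u \<in> adm_fin f XX UU N x. J_fin f ell N x u)"

definition V_inf ::
  "('x \<times> 'u \<Rightarrow> 'x) \<Rightarrow> ('x \<times> 'u \<Rightarrow> real) \<Rightarrow> 'x set \<Rightarrow> 'u set \<Rightarrow> 'x \<Rightarrow> ereal" where
  "V_inf f ell XX UU x = (INF u \<in> adm_inf f XX UU x. J_inf f ell x u)"

(* uN assigns to each state the open loop control chosen there; m i is the number of
   its elements that are applied after the i-th update. *)
primrec closed_loop ::
  "('x \<times> 'u \<Rightarrow> 'x) \<Rightarrow> ('x \<Rightarrow> nat \<Rightarrow> 'u) \<Rightarrow> (nat \<Rightarrow> nat) \<Rightarrow> 'x \<Rightarrow> nat \<Rightarrow> 'x" where
  "closed_loop f uN m x0 0 = x0"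
| "closed_loop f uN m x0 (Suc i) =
     traj f (uN (closed_loop f uN m x0 i)) (closed_loop f uN m x0 i) (m i)"

definition V_closed_loop ::
  "('x \<times> 'u \<Rightarrow> 'x) \<Rightarrow> ('x \<times> 'u \<Rightarrow> real) \<Rightarrow> ('x \<Rightarrow> nat \<Rightarrow> 'u) \<Rightarrow> (nat \<Rightarrow> nat) \<Rightarrow> 'x \<Rightarrow> ereal" where
  "V_closed_loop f ell uN m x0 =
     (\<Sum>i. ereal (\<Sum>k<m i. ell (traj f (uN (closed_loop f uN m x0 i)) (closed_loop f uN m x0 i) k,
                           uN (closed_loop f uN m x0 i) k)))"

end

theory Submission imports Defs begin

text \<open>
  Write \<open>c i\<close> for the cost of the steps applied between the updates \<open>i\<close> and \<open>i + 1\<close>, and \<open>v i\<close>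
  for the finite horizon value \<open>V\<^sub>N(x i)\<close>. Since \<open>\<rho> i = v i - v (i + 1) - \<alpha>b c i\<close>, the sum
  telescopes to \<open>s n = v 0 - v (n + 1) - \<alpha>b (c 0 + \<dots> + c n)\<close>
  (\<open>telescoped_relaxed_decrease\<close>).

  For the first claim, this makes the denominator equal to \<open>\<alpha>b\<close> times the accumulated cost, so the
  proposed value is the quotient of \<open>v 0 - v (n + 1)\<close> by the accumulated cost. The latter is
  positive because already the first applied step starts away from the equilibrium, and so the
  quotient is the exact threshold for \<open>\<alpha>\<close>.

  For the second claim there are three independent estimates. The middle one follows from
  \<open>v (n + 1) \<ge> 0\<close>: in the limit the accumulated cost is at most \<open>(v 0 - \<theta>) / \<alpha>b\<close>
  (\<open>limit_suboptimality_bound\<close>). The right one holds since truncating an infinite control gives an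
  admissible finite one of no larger cost (\<open>V_fin_le_V_inf\<close>). For the left one, the pieces of open
  loop controls that the feedback applies are glued together to one infinite control
  (\<open>glued_control\<close>). It is admissible and its cost is the closed loop cost
  (\<open>V_inf_le_V_closed_loop\<close>), and the factor \<open>\<alpha>\<close> is nonnegative.
\<close>

section \<open>Trajectories and value functions\<close>

lemma traj_cong:
  assumes "\<And>k. k < n \<Longrightarrow> u k = v k"
  shows "traj f u x n = traj f v x n"
  using assms by (induction n) auto

lemma traj_add: "traj f u x (a + k) = traj f (\<lambda>j. u (a + j)) (traj f u x a) k"
  by (induction k) auto

lemma V_fin_nonneg:
  assumes "adm_fin f XX UU N x \<noteq> {}" and "\<And>y v. ell (y, v) \<ge> 0"
  shows "V_fin f ell XX UU N x \<ge> 0"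
  unfolding V_fin_def using assms by (auto intro!: cINF_greatest sum_nonneg simp: J_fin_def)

lemma V_fin_le_V_inf:
  assumes nonneg: "\<And>y v. ell (y, v) \<ge> 0"
  shows "ereal (V_fin f ell XX UU N x) \<le> V_inf f ell XX UU x"
  unfolding V_inf_def
proof (rule INF_greatest)
  fix u assume "u \<in> adm_inf f XX UU x"
  then have "u \<in> adm_fin f XX UU N x"
    by (auto simp: adm_inf_def adm_fin_def)
  moreover have "bdd_below (J_fin f ell N x ` adm_fin f XX UU N x)"
    by (rule bdd_belowI[of _ 0]) (auto simp: J_fin_def intro!: sum_nonneg nonneg)
  ultimately have "V_fin f ell XX UU N x \<le> J_fin f ell N x u"
    unfolding V_fin_def by (rule cINF_lower[rotated])
  also have "ereal (J_fin f ell N x u) \<le> J_inf f ell x u"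
    unfolding J_fin_def J_inf_def sum_ereal[symmetric]
    by (rule suminf_upper) (simp add: nonneg)
  finally show "ereal (V_fin f ell XX UU N x) \<le> J_inf f ell x u" by simp
qed

section \<open>The closed loop as an infinite horizon control\<close>

lemma sum_lessThan_add:
  fixes g :: "nat \<Rightarrow> 'a::comm_monoid_add"
  shows "(\<Sum>n<a + b. g n) = (\<Sum>n<a. g n) + (\<Sum>k<b. g (a + k))"
  by (induction b) (simp_all add: add.assoc)

lemma block_decomposition:
  fixes \<sigma> m :: "nat \<Rightarrow> nat"
  assumes "\<sigma> 0 = 0" and "\<And>i. \<sigma> (Suc i) = \<sigma> i + m i" and "\<And>i. 0 < m i"
  obtains i k where "n = \<sigma> i + k" and "k < m i"
proof -
  have "\<exists>i k. n = \<sigma> i + k \<and> k < m i"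
  proof (induction n)
    case 0
    show ?case using assms by (intro exI[of _ 0]) simp
  next
    case (Suc n)
    then obtain i k where ik: "n = \<sigma> i + k" "k < m i" by blast
    show ?case
    proof (cases "Suc k < m i")
      case True
      with ik show ?thesis by (intro exI[of _ i] exI[of _ "Suc k"]) simp
    next
      case False
      with ik assms show ?thesis by (intro exI[of _ "Suc i"] exI[of _ 0]) simp
    qed
  qed
  with that show thesis by blast
qed

definition update_index :: "(nat \<Rightarrow> nat) \<Rightarrow> nat \<Rightarrow> nat" where
  "update_index \<sigma> n = (THE i. \<sigma> i \<le> n \<and> n < \<sigma> (Suc i))"

lemma update_index_eq:
  assumes mono: "strict_mono \<sigma>" and "\<sigma> i \<le> n" and "n < \<sigma> (Suc i)"
  shows "update_index \<sigma> n = i"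
  unfolding update_index_def
proof (rule the_equality)
  show "\<sigma> i \<le> n \<and> n < \<sigma> (Suc i)" using assms by simp
  fix j assume j: "\<sigma> j \<le> n \<and> n < \<sigma> (Suc j)"
  with assms have "\<sigma> j < \<sigma> (Suc i)" "\<sigma> i < \<sigma> (Suc j)" by linarith+
  then show "j = i" using strict_mono_less[OF mono] by (metis less_SucE less_asym)
qed

definition glued_control :: "(nat \<Rightarrow> nat) \<Rightarrow> (nat \<Rightarrow> nat \<Rightarrow> 'u) \<Rightarrow> nat \<Rightarrow> 'u" where
  "glued_control \<sigma> w n = w (update_index \<sigma> n) (n - \<sigma> (update_index \<sigma> n))"

lemma glued_control_block:
  assumes "strict_mono \<sigma>" and "\<sigma> i + k < \<sigma> (Suc i)"
  shows "glued_control \<sigma> w (\<sigma> i + k) = w i k"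
  using update_index_eq[OF assms(1), of i "\<sigma> i + k"] assms(2) by (simp add: glued_control_def)

text \<open>
  Following the glued control means following the \<open>i\<close>th piece on the \<open>i\<close>th block, since at the
  block boundaries the next piece starts from the state that the previous one has reached. The
  endpoint \<open>k = m i\<close> is included because it carries the induction to the next block.
\<close>
lemma traj_glued_control:
  assumes \<sigma>0: "\<sigma> 0 = 0" and \<sigma>Suc: "\<And>i. \<sigma> (Suc i) = \<sigma> i + m i" and mono: "strict_mono \<sigma>"
    and x: "\<And>i. x (Suc i) = traj f (w i) (x i) (m i)"
    and "k \<le> m i"
  shows "traj f (glued_control \<sigma> w) (x 0) (\<sigma> i + k) = traj f (w i) (x i) k"
proof -
  let ?u = "glued_control \<sigma> w"
  have block: "traj f ?u (x 0) (\<sigma> i + k) = traj f (w i) (x i) k"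
    if "traj f ?u (x 0) (\<sigma> i) = x i" "k \<le> m i" for i k
  proof -
    have "traj f ?u (x 0) (\<sigma> i + k) = traj f (\<lambda>j. ?u (\<sigma> i + j)) (x i) k"
      by (simp add: traj_add that(1))
    also have "\<dots> = traj f (w i) (x i) k"
      using that(2) \<sigma>Suc by (intro traj_cong glued_control_block mono) auto
    finally show ?thesis .
  qed
  have "traj f ?u (x 0) (\<sigma> i) = x i" for i
  proof (induction i)
    case (Suc i)
    from block[OF this, of "m i"] show ?case by (simp add: \<sigma>Suc x)
  qed (simp add: \<sigma>0)
  from block[OF this \<open>k \<le> m i\<close>] show ?thesis .
qed

text \<open>
  The closed loop cost sums the same nonnegative stage costs in blocks, so that its partial sums
  are the partial sums of the infinite horizon cost along the subsequence \<open>\<sigma>\<close>.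
\<close>
lemma J_inf_glued_control:
  assumes \<sigma>0: "\<sigma> 0 = 0" and \<sigma>Suc: "\<And>i. \<sigma> (Suc i) = \<sigma> i + m i" and mono: "strict_mono \<sigma>"
    and x: "\<And>i. x (Suc i) = traj f (w i) (x i) (m i)"
    and nonneg: "\<And>y v. ell (y, v) \<ge> 0"
  shows "J_inf f ell (x 0) (glued_control \<sigma> w) =
    (\<Sum>i. ereal (\<Sum>k<m i. ell (traj f (w i) (x i) k, w i k)))"
proof -
  let ?u = "glued_control \<sigma> w"
  let ?c = "\<lambda>i. \<Sum>k<m i. ell (traj f (w i) (x i) k, w i k)"
  let ?g = "\<lambda>n. ell (traj f ?u (x 0) n, ?u n)"
  have partial: "(\<Sum>n<\<sigma> j. ?g n) = (\<Sum>i<j. ?c i)" for j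
  proof (induction j)
    case (Suc j)
    have "(\<Sum>n<\<sigma> (Suc j). ?g n) = (\<Sum>n<\<sigma> j. ?g n) + (\<Sum>k<m j. ?g (\<sigma> j + k))"
      by (simp add: \<sigma>Suc sum_lessThan_add)
    also have "(\<Sum>k<m j. ?g (\<sigma> j + k)) = ?c j"
      using \<sigma>Suc by (intro sum.cong)
        (auto simp: traj_glued_control[of \<sigma> m x f w, OF \<sigma>0 \<sigma>Suc mono x] glued_control_block[OF mono])
    finally show ?case using Suc by simp
  qed (simp add: \<sigma>0)
  have "(\<lambda>n. ereal (?g n)) sums J_inf f ell (x 0) ?u"
    unfolding J_inf_def by (intro summable_sums summable_ereal_pos) (simp add: nonneg)
  then have "(\<lambda>j. \<Sum>n<\<sigma> j. ereal (?g n)) \<longlonglongrightarrow> J_inf f ell (x 0) ?u"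
    unfolding sums_def using LIMSEQ_subseq_LIMSEQ[OF _ mono] by (auto simp: comp_def)
  then have "(\<lambda>i. ereal (?c i)) sums J_inf f ell (x 0) ?u"
    by (simp add: sums_def partial)
  then show ?thesis by (simp add: sums_iff)
qed

lemma closed_loop_in_constraint:
  assumes "x0 \<in> XX" and "\<And>y. y \<in> XX \<Longrightarrow> uN y \<in> adm_fin f XX UU N y"
    and "\<And>i. m i \<in> {1..N}"
  shows "closed_loop f uN m x0 i \<in> XX"
  using assms by (induction i) (auto simp: adm_fin_def)

lemma V_inf_le_V_closed_loop:
  assumes \<sigma>0: "\<sigma> 0 = 0" and \<sigma>Suc: "\<And>i. \<sigma> (Suc i) = \<sigma> i + m i" and m: "\<And>i. m i \<in> {1..N}"
    and nonneg: "\<And>y v. ell (y, v) \<ge> 0"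
    and "x0 \<in> XX" and adm: "\<And>y. y \<in> XX \<Longrightarrow> uN y \<in> adm_fin f XX UU N y"
  shows "V_inf f ell XX UU x0 \<le> V_closed_loop f ell uN m x0"
proof -
  define x where "x = closed_loop f uN m x0"
  define w where "w i = uN (x i)" for i
  let ?u = "glued_control \<sigma> w"
  have mpos: "0 < m i" for i using m[of i] by simp
  have mono: "strict_mono \<sigma>" using mpos by (simp add: strict_mono_Suc_iff \<sigma>Suc)
  have xXX: "x i \<in> XX" for i
    unfolding x_def using \<open>x0 \<in> XX\<close> adm m by (rule closed_loop_in_constraint)
  have xSuc: "x (Suc i) = traj f (w i) (x i) (m i)" for i by (simp add: x_def w_def)
  have "?u \<in> adm_inf f XX UU (x 0)"
  proof -
    have "?u n \<in> UU \<and> traj f ?u (x 0) n \<in> XX" for n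
    proof -
      obtain i k where ik: "n = \<sigma> i + k" "k < m i"
        using block_decomposition[of \<sigma> m n, OF \<sigma>0 \<sigma>Suc mpos] by blast
      have "w i \<in> adm_fin f XX UU N (x i)" unfolding w_def by (rule adm[OF xXX])
      moreover have "k < N" using ik(2) m[of i] by simp
      ultimately have "w i k \<in> UU" and "k \<ge> 1 \<Longrightarrow> traj f (w i) (x i) k \<in> XX"
        by (simp_all add: adm_fin_def Pi_iff)
      moreover have "traj f (w i) (x i) 0 \<in> XX" using xXX by simp
      ultimately have "w i k \<in> UU" "traj f (w i) (x i) k \<in> XX"
        by (cases k; simp)+
      then show ?thesis
        using ik traj_glued_control[of \<sigma> m x f w k i, OF \<sigma>0 \<sigma>Suc mono xSuc]
          glued_control_block[OF mono, of i k w] by (simp add: \<sigma>Suc)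
    qed
    then show ?thesis by (simp add: adm_inf_def)
  qed
  then have "V_inf f ell XX UU (x 0) \<le> J_inf f ell (x 0) ?u"
    unfolding V_inf_def by (rule INF_lower)
  also have "\<dots> = V_closed_loop f ell uN m x0"
    using J_inf_glued_control[of \<sigma> m x f w ell, OF \<sigma>0 \<sigma>Suc mono xSuc nonneg]
    by (simp add: V_closed_loop_def x_def w_def)
  finally show ?thesis by (simp add: x_def)
qed

section \<open>The relaxed decrease condition, summed\<close>

lemma telescoped_relaxed_decrease:
  fixes v c :: "nat \<Rightarrow> real"
  shows "(\<Sum>i=0..n. v i - v (Suc i) - a * c i) = v 0 - v (Suc n) - a * (\<Sum>i=0..n. c i)"
  by (induction n) (auto simp: algebra_simps)

lemma is_arg_max_threshold:
  fixes A B C :: real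
  assumes "C > 0"
  shows "is_arg_max (\<lambda>\<alpha>. \<alpha>) (\<lambda>\<alpha>. B + \<alpha> * C \<le> A) ((A - B) / C)"
  using assms by (auto simp: is_arg_max_def field_simps)

text \<open>
  Every accumulated cost is at most \<open>(v 0 - \<theta>) / a\<close>: the identity bounds it by \<open>(v 0 - s k) / a\<close>
  for each later \<open>k\<close>, as the costs and \<open>v\<close> are nonnegative. In particular the total cost is finite,
  and \<open>\<theta> \<le> v 0\<close>.
\<close>
lemma limit_suboptimality_bound:
  fixes v c s :: "nat \<Rightarrow> real" and a \<theta> :: real
  assumes "a > 0" and v: "\<And>i. v i \<ge> 0" and c: "\<And>i. c i \<ge> 0"
    and s: "\<And>n. s n = v 0 - v (Suc n) - a * (\<Sum>i=0..n. c i)"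
    and lim: "s \<longlonglongrightarrow> \<theta>"
  shows "\<theta> \<le> v 0"
    and "ereal (a * v 0 / (v 0 - \<theta>)) * (\<Sum>i. ereal (c i)) \<le> ereal (v 0)"
proof -
  have bound: "a * (\<Sum>i<n. c i) \<le> v 0 - \<theta>" for n
  proof -
    have "s k \<le> v 0 - a * (\<Sum>i<n. c i)" if "k \<ge> n" for k
    proof -
      have "(\<Sum>i<n. c i) \<le> (\<Sum>i=0..k. c i)"
        using that c by (intro sum_mono2) auto
      then have "a * (\<Sum>i<n. c i) \<le> a * (\<Sum>i=0..k. c i)"
        using \<open>a > 0\<close> by (intro mult_left_mono) auto
      then show ?thesis using v[of "Suc k"] s[of k] by linarith
    qed
    then have "\<theta> \<le> v 0 - a * (\<Sum>i<n. c i)"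
      by (intro LIMSEQ_le_const2[OF lim]) blast
    then show ?thesis by simp
  qed
  from bound[of 0] show \<theta>: "\<theta> \<le> v 0" by simp
  show "ereal (a * v 0 / (v 0 - \<theta>)) * (\<Sum>i. ereal (c i)) \<le> ereal (v 0)"
  proof (cases "v 0 = \<theta>")
    \<comment> \<open>Division by zero makes the factor zero here, which annihilates any extended real.\<close>
    case True
    then show ?thesis using v[of 0] by (simp add: zero_ereal_def[symmetric])
  next
    case False
    have "(\<Sum>i. ereal (c i)) \<le> ereal ((v 0 - \<theta>) / a)"
    proof (rule suminf_bound)
      show "\<forall>n. (\<Sum>i<n. ereal (c i)) \<le> ereal ((v 0 - \<theta>) / a)"
        using bound \<open>a > 0\<close> by (simp add: field_simps)
    qed (simp add: c)
    then have "ereal (a * v 0 / (v 0 - \<theta>)) * (\<Sum>i. ereal (c i))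
        \<le> ereal (a * v 0 / (v 0 - \<theta>)) * ereal ((v 0 - \<theta>) / a)"
      using \<theta> v[of 0] \<open>a > 0\<close> by (intro ereal_mult_left_mono) auto
    also have "\<dots> = ereal (v 0)" using False \<open>a > 0\<close> by simp
    finally show ?thesis .
  qed
qed

theorem corollary6p3:
  fixes f :: "'x::banach \<times> 'u::banach \<Rightarrow> 'x"
    and ell :: "'x \<times> 'u \<Rightarrow> real"
    and XX :: "'x set" and UU :: "'u set"
    and xstar :: 'x and ustar :: 'u
    and N :: nat and uN :: "'x \<Rightarrow> nat \<Rightarrow> 'u"
    and \<sigma> m :: "nat \<Rightarrow> nat"
    and x0 :: 'x and x :: "nat \<Rightarrow> 'x"
    and \<alpha>b :: real and \<rho> s :: "nat \<Rightarrow> real"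
  assumes "xstar \<in> XX" and "ustar \<in> UU" and "f (xstar, ustar) = xstar"
    and "continuous_on UNIV ell"
    and "\<And>y v. ell (y, v) \<ge> 0"
    and "ell (xstar, ustar) = 0"
    and "\<And>y v. y \<noteq> xstar \<Longrightarrow> ell (y, v) > 0"
    and viability: "\<And>y. y \<in> XX \<Longrightarrow> \<exists>v\<in>UU. f (y, v) \<in> XX"
    and "N \<ge> 2"
    and minimizer: "\<And>y. y \<in> XX \<Longrightarrow>
          is_arg_min (J_fin f ell N y) (\<lambda>u. u \<in> adm_fin f XX UU N y) (uN y)"
    and "\<sigma> 0 = 0"
    and "\<And>i. m i = \<sigma> (i + 1) - \<sigma> i" and "\<And>i. m i \<in> {1..N - 1}"
    and "x0 \<in> XX"
    and "x = closed_loop f uN m x0"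
    and "\<alpha>b \<in> {0<..1}"
    and "\<And>i. \<rho> i = V_fin f ell XX UU N (x i) - V_fin f ell XX UU N (traj f (uN (x i)) (x i) (m i))
             - \<alpha>b * (\<Sum>k<m i. ell (traj f (uN (x i)) (x i) k, uN (x i) k))"
    and "\<And>n. s n = (\<Sum>i=0..n. \<rho> i)"
  shows "(x0 \<noteq> xstar \<longrightarrow>
           (\<forall>n. is_arg_max (\<lambda>\<alpha>::real. \<alpha>)
              (\<lambda>\<alpha>. V_fin f ell XX UU N (x (n + 1))
                   + \<alpha> * (\<Sum>i=0..n. \<Sum>k<m i. ell (traj f (uN (x i)) (x i) k, uN (x i) k))
                   \<le> V_fin f ell XX UU N x0)
              ((V_fin f ell XX UU N x0 - V_fin f ell XX UU N (x (n + 1)))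
               / (V_fin f ell XX UU N x0 - V_fin f ell XX UU N (x (n + 1)) - s n) * \<alpha>b)))
       \<and> (\<forall>\<theta>. s \<longlonglongrightarrow> \<theta> \<longrightarrow>
           (let \<alpha> = \<alpha>b * V_fin f ell XX UU N x0 / (V_fin f ell XX UU N x0 - \<theta>) in
              ereal \<alpha> * V_inf f ell XX UU x0 \<le> ereal \<alpha> * V_closed_loop f ell uN m x0
            \<and> ereal \<alpha> * V_closed_loop f ell uN m x0 \<le> ereal (V_fin f ell XX UU N x0)
            \<and> ereal (V_fin f ell XX UU N x0) \<le> V_inf f ell XX UU x0))"
proof -
  have nonneg: "\<And>y v. ell (y, v) \<ge> 0" by fact
  have mN: "m i \<in> {1..N - 1}" for i by fact
  have m: "m i \<in> {1..N}" for i using mN[of i] by auto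
  have \<sigma>Suc: "\<sigma> (Suc i) = \<sigma> i + m i" for i
    using mN[of i] assms(12)[of i, folded Suc_eq_plus1] by (cases "\<sigma> i \<le> \<sigma> (Suc i)") simp_all
  have \<alpha>b: "\<alpha>b > 0" using \<open>\<alpha>b \<in> {0<..1}\<close> by simp
  have adm: "uN y \<in> adm_fin f XX UU N y" if "y \<in> XX" for y
    using minimizer[OF that] by (simp add: is_arg_min_def)
  have x: "x i = closed_loop f uN m x0 i" for i using \<open>x = closed_loop f uN m x0\<close> by simp
  have xXX: "x i \<in> XX" for i
    unfolding x using \<open>x0 \<in> XX\<close> adm m by (rule closed_loop_in_constraint)
  have xSuc: "x (Suc i) = traj f (uN (x i)) (x i) (m i)" and x_0: "x 0 = x0" for i
    by (simp_all add: x)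
  define v where "v i = V_fin f ell XX UU N (x i)" for i
  define c where "c i = (\<Sum>k<m i. ell (traj f (uN (x i)) (x i) k, uN (x i) k))" for i
  have v_nonneg: "v i \<ge> 0" for i
    unfolding v_def using adm[OF xXX[of i]] by (intro V_fin_nonneg nonneg) blast
  have c_nonneg: "c i \<ge> 0" for i
    unfolding c_def by (intro sum_nonneg nonneg)
  have v_0: "V_fin f ell XX UU N x0 = v 0" by (simp add: v_def x_0)
  have "\<rho> i = v i - v (Suc i) - \<alpha>b * c i" for i
    using assms(17)[of i] by (simp add: v_def c_def xSuc)
  then have s: "s n = v 0 - v (Suc n) - \<alpha>b * (\<Sum>i=0..n. c i)" for n
    by (simp add: assms(18) telescoped_relaxed_decrease)
  have largest: "is_arg_max (\<lambda>\<alpha>::real. \<alpha>)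
      (\<lambda>\<alpha>. v (Suc n) + \<alpha> * (\<Sum>i=0..n. c i) \<le> v 0)
      ((v 0 - v (Suc n)) / (v 0 - v (Suc n) - s n) * \<alpha>b)" if "x0 \<noteq> xstar" for n
  proof -
    have "0 < ell (x0, uN x0 0)" using assms(7) that by blast
    also have "\<dots> \<le> c 0"
      unfolding c_def using m[of 0]
      by (intro order_trans[OF _ member_le_sum[of 0]]) (auto simp: x_0 nonneg)
    also have "c 0 \<le> (\<Sum>i=0..n. c i)"
      by (intro member_le_sum) (auto simp: c_nonneg)
    finally have "0 < (\<Sum>i=0..n. c i)" .
    then show ?thesis using is_arg_max_threshold \<alpha>b by (simp add: s)
  qed
  have estimates: "ereal \<alpha> * V_inf f ell XX UU x0 \<le> ereal \<alpha> * V_closed_loop f ell uN m x0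
      \<and> ereal \<alpha> * V_closed_loop f ell uN m x0 \<le> ereal (v 0)
      \<and> ereal (v 0) \<le> V_inf f ell XX UU x0"
    if lim: "s \<longlonglongrightarrow> \<theta>" and \<alpha>: "\<alpha> = \<alpha>b * v 0 / (v 0 - \<theta>)" for \<theta> \<alpha>
  proof (intro conjI)
    note bounds = limit_suboptimality_bound[OF \<alpha>b v_nonneg c_nonneg s lim]
    have closed_loop_cost: "V_closed_loop f ell uN m x0 = (\<Sum>i. ereal (c i))"
      by (simp add: V_closed_loop_def c_def x)
    have "\<alpha> \<ge> 0" unfolding \<alpha> using bounds(1) v_nonneg[of 0] \<alpha>b by simp
    moreover have "V_inf f ell XX UU x0 \<le> V_closed_loop f ell uN m x0"
      using \<open>\<sigma> 0 = 0\<close> \<sigma>Suc m nonneg \<open>x0 \<in> XX\<close> adm by (rule V_inf_le_V_closed_loop)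
    ultimately show "ereal \<alpha> * V_inf f ell XX UU x0 \<le> ereal \<alpha> * V_closed_loop f ell uN m x0"
      by (intro ereal_mult_left_mono) auto
    show "ereal \<alpha> * V_closed_loop f ell uN m x0 \<le> ereal (v 0)"
      unfolding closed_loop_cost \<alpha> by (rule bounds(2))
    show "ereal (v 0) \<le> V_inf f ell XX UU x0"
      unfolding v_0[symmetric] by (rule V_fin_le_V_inf) (rule nonneg)
  qed
  show ?thesis
    using largest estimates by (auto simp: v_0 v_def[symmetric] c_def[symmetric] Let_def)
qed

end
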